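(* Let $n\ge1$ and $e,k\ge0$. There is a bijection between the set of bi-increasing permutations $\pi\in{\cal S}_n$ with ${\sf exc}(\pi)=e$ and ${\sf dexc}(\pi)=k$ and the set of parallelogram polyominoes of perimeter $2n+2$, width $e+1$ and area $n+k-e$.
   Context: Permutations $\pi\in{\cal S}_n$ are written as words $\pi_1\cdots\pi_n$. An excedance of $\pi$ is an integer $i\in[n-1]$ with $\pi_i>i$; ${\sf E}(\pi)$ is the set of excedances, ${\sf exc}(\pi)=|{\sf E}(\pi)|$, ${\sf dexc}(\pi)=\sum_{i\in{\sf E}(\pi)}(\pi_i-i)$, and ${\sf inv}(\pi)$ is the number of pairs $i<j$ with $\pi_i>\pi_j$. A permutation is bi-increasing if ${\sf inv}(\pi)={\sf dexc}(\pi)$. A parallelogram polyomino is a finite union of unit cells of the plane bounded by two lattice paths that start at the origin, use only unit steps north $[0,1]$ and east $[1,0]$, end at a common point, and meet only at their start and end points. Its width and height are the coordinates of the common end point, its perimeter is the total boundary length (twice the sum of width and height), and its area is its number of cells. *)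

theory Defs
  imports "HOL-Combinatorics.Permutations" "HOL-Library.Product_Plus"
begin

text \<open>A permutation in \<open>S\<^sub>n\<close> is a function \<open>p :: nat \<Rightarrow> nat\<close> with \<open>p permutes {1..n}\<close>.\<close>

definition excedances :: "nat \<Rightarrow> (nat \<Rightarrow> nat) \<Rightarrow> nat set" where
  "excedances n p = {i \<in> {1..n - 1}. p i > i}"

definition exc :: "nat \<Rightarrow> (nat \<Rightarrow> nat) \<Rightarrow> nat" where
  "exc n p = card (excedances n p)"

text \<open>The truncated subtraction is harmless, as \<open>p i > i\<close> for every excedance \<open>i\<close>.\<close>

definition dexc :: "nat \<Rightarrow> (nat \<Rightarrow> nat) \<Rightarrow> nat" where
  "dexc n p = (\<Sum>i\<in>excedances n p. p i - i)"

definition inversion_number :: "nat \<Rightarrow> (nat \<Rightarrow> nat) \<Rightarrow> nat" where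
  "inversion_number n p =
    card {(i, j). i \<in> {1..n} \<and> j \<in> {1..n} \<and> i < j \<and> p i > p j}"

definition bi_increasing :: "nat \<Rightarrow> (nat \<Rightarrow> nat) \<Rightarrow> bool" where
  "bi_increasing n p \<longleftrightarrow> inversion_number n p = dexc n p"

datatype step = North | East

type_synonym point = "int \<times> int"

fun step_vec :: "step \<Rightarrow> point" where
  "step_vec North = (0, 1)"
| "step_vec East = (1, 0)"

text \<open>
  The pair \<open>(q, s)\<close> encodes the unit segment from \<open>q\<close> to \<open>q + step_vec s\<close>.
  The unit cell \<open>[x, x + 1] \<times> [y, y + 1]\<close> is encoded by its lower left corner \<open>(x, y)\<close>.
\<close>

type_synonym edge = "point \<times> step"
type_synonym cell = "int \<times> int"

fun path_vertices :: "point \<Rightarrow> step list \<Rightarrow> point set" where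
  "path_vertices q [] = {q}"
| "path_vertices q (s # ss) = insert q (path_vertices (q + step_vec s) ss)"

fun path_edges :: "point \<Rightarrow> step list \<Rightarrow> edge set" where
  "path_edges q [] = {}"
| "path_edges q (s # ss) = insert (q, s) (path_edges (q + step_vec s) ss)"

fun path_end :: "point \<Rightarrow> step list \<Rightarrow> point" where
  "path_end q [] = q"
| "path_end q (s # ss) = path_end (q + step_vec s) ss"

fun cell_edges :: "cell \<Rightarrow> edge set" where
  "cell_edges (x, y) = {((x, y), East), ((x, y), North), ((x, y + 1), East), ((x + 1, y), North)}"

text \<open>
  Every unit segment is a side of exactly two cells of the plane; it lies on the boundary of a
  union of cells iff exactly one of these two belongs to the union.
\<close>

definition boundary :: "cell set \<Rightarrow> edge set" where
  "boundary P = {d. \<exists>!c. c \<in> P \<and> d \<in> cell_edges c}"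

definition perimeter :: "cell set \<Rightarrow> nat" where
  "perimeter P = card (boundary P)"

text \<open>
  \<open>parallelogram_polyomino w h P\<close>: the cells \<open>P\<close> form a parallelogram polyomino whose two
  bounding paths start at the origin and end at \<open>(w, h)\<close>, so \<open>w\<close> is its width and \<open>h\<close> its height.
  Two lattice paths meet, as curves in the plane, in their common vertices and common edges.
\<close>

definition parallelogram_polyomino :: "nat \<Rightarrow> nat \<Rightarrow> cell set \<Rightarrow> bool" where
  "parallelogram_polyomino w h P \<longleftrightarrow>
    finite P \<and> P \<noteq> {} \<and>
    (\<exists>U L. path_end (0, 0) U = (int w, int h) \<and> path_end (0, 0) L = (int w, int h) \<and>
      path_vertices (0, 0) U \<inter> path_vertices (0, 0) L = {(0, 0), (int w, int h)} \<and>
      path_edges (0, 0) U \<inter> path_edges (0, 0) L = {} \<and>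
      boundary P = path_edges (0, 0) U \<union> path_edges (0, 0) L)"

end

theory Submission
  imports Defs "HOL-Library.Infinite_Set"
begin

text \<open>
  Let \<open>E\<close> be the set of excedances of \<open>p\<close>. The number \<open>dexc\<close> counts the inversions \<open>(i, j)\<close> with
  \<open>i \<in> E\<close> and \<open>j \<notin> E\<close>, and no inversion has \<open>i \<notin> E\<close> and \<open>j \<in> E\<close>. Hence \<open>p\<close> is bi-increasing iff it
  is increasing on \<open>E\<close> and on the complement of \<open>E\<close>, and such a \<open>p\<close> is determined by \<open>E\<close> and \<open>p ` E\<close>.
  A pair \<open>(I, J)\<close> of sets of equal size arises in this way iff for every \<open>t\<close> at least as many
  elements of \<open>I\<close> lie below \<open>t\<close> as elements of \<open>J\<close> lie weakly below \<open>t\<close>. This is the condition that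
  the path with East steps at the times \<open>J \<union> {n + 1}\<close> stays strictly above the path with East
  steps at the times \<open>{1} \<union> (I + 1)\<close>. Slicing the enclosed region along antidiagonals, its area is
  the difference of the sums of these two sets of times.
\<close>

subsection \<open>Bi-increasing permutations\<close>

text \<open>Both sets are enumerated increasingly by the same ranks \<open>{..<card M}\<close>;
  elements of equal rank are matched.\<close>

lemma ex_strict_mono_on_bij_betw:
  fixes M N :: "nat set"
  assumes "finite M" "finite N" "card M = card N"
  shows "\<exists>g. bij_betw g M N \<and> strict_mono_on M g"
proof -
  obtain h where h: "bij_betw h {..<card M} M" "strict_mono_on {..<card M} h"
    using ex_bij_betw_strict_mono_card[OF assms(1)] .
  obtain k where k: "bij_betw k {..<card M} N" "strict_mono_on {..<card M} k"
    using ex_bij_betw_strict_mono_card[OF assms(2)] assms(3) by metis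
  let ?i = "inv_into {..<card M} h"
  have i: "bij_betw ?i M {..<card M}"
    using bij_betw_inv_into[OF h(1)] .
  have "strict_mono_on M (k \<circ> ?i)"
  proof (rule strict_mono_onI)
    fix x y assume xy: "x \<in> M" "y \<in> M" "x < y"
    have m: "?i x \<in> {..<card M}" "?i y \<in> {..<card M}"
      using i xy by (auto dest: bij_betwE)
    have "h (?i x) = x" "h (?i y) = y"
      using bij_betw_inv_into_right[OF h(1)] xy by auto
    then have "?i x < ?i y"
      using strict_mono_onD[OF h(2) m(2) m(1)] xy(3) by (cases "?i x" "?i y" rule: linorder_cases) auto
    then show "(k \<circ> ?i) x < (k \<circ> ?i) y"
      using strict_mono_onD[OF k(2) m] by simp
  qed
  then show ?thesis
    using bij_betw_trans[OF i k(1)] by blast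
qed

text \<open>Increasing maps preserve ranks: values are ordered as their arguments, so initial
  segments correspond bijectively.\<close>

lemma card_image_below_strict_mono_on:
  fixes f :: "nat \<Rightarrow> nat"
  assumes "strict_mono_on S f" "x \<in> S"
  shows "card (f ` S \<inter> {..<f x}) = card (S \<inter> {..<x})"
    and "card (f ` S \<inter> {..f x}) = card (S \<inter> {..x})"
proof -
  have less: "f y < f x \<longleftrightarrow> y < x" if "y \<in> S" for y
    using strict_mono_onD[OF assms(1)] that assms(2)
    by (metis linorder_cases order_less_asym order_less_irrefl)
  have le: "f y \<le> f x \<longleftrightarrow> y \<le> x" if "y \<in> S" for y
    using strict_mono_onD[OF assms(1)] that assms(2)
    by (metis less linorder_not_less order_le_less)
  have inj: "inj_on f T" if "T \<subseteq> S" for T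
    using strict_mono_on_imp_inj_on[OF assms(1)] that by (rule inj_on_subset)
  have "f ` S \<inter> {..<f x} = f ` (S \<inter> {..<x})"
    using less by auto
  then show "card (f ` S \<inter> {..<f x}) = card (S \<inter> {..<x})"
    using inj by (simp add: card_image)
  have "f ` S \<inter> {..f x} = f ` (S \<inter> {..x})"
    using le by auto
  then show "card (f ` S \<inter> {..f x}) = card (S \<inter> {..x})"
    using inj by (simp add: card_image)
qed

lemma card_below_strict:
  fixes K :: "nat set"
  assumes "a \<in> K" "a < b"
  shows "card (K \<inter> {..<a}) < card (K \<inter> {..<b})"
  using assms by (intro psubset_card_mono) auto

text \<open>Both values have the same rank in the common image, namely that of \<open>x\<close> in
  \<open>S\<close>, and an element is determined by its rank.\<close>

lemma strict_mono_on_unique: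
  fixes f g :: "nat \<Rightarrow> nat"
  assumes "strict_mono_on S f" "strict_mono_on S g" "f ` S = g ` S" "x \<in> S"
  shows "f x = g x"
proof -
  have "card (f ` S \<inter> {..<f x}) = card (f ` S \<inter> {..<g x})"
    using card_image_below_strict_mono_on(1)[OF assms(1,4)]
      card_image_below_strict_mono_on(1)[OF assms(2,4)] assms(3) by simp
  moreover have "f x \<in> f ` S" "g x \<in> f ` S"
    using assms by auto
  ultimately show ?thesis
    using card_below_strict by (metis linorder_neqE_nat order_less_irrefl)
qed

section \<open>Inversions split by blocks of positions\<close>

definition inversions :: "(nat \<Rightarrow> nat) \<Rightarrow> nat set \<Rightarrow> nat set \<Rightarrow> (nat \<times> nat) set" where
  "inversions p A B = {(i, j). i \<in> A \<and> j \<in> B \<and> i < j \<and> p i > p j}"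

lemma finite_inversions: "finite A \<Longrightarrow> finite B \<Longrightarrow> finite (inversions p A B)"
  by (rule finite_subset[of _ "A \<times> B"]) (auto simp: inversions_def)

lemma card_inversions_Un_left:
  assumes "finite A" "finite A'" "finite B" "A \<inter> A' = {}"
  shows "card (inversions p (A \<union> A') B) = card (inversions p A B) + card (inversions p A' B)"
proof -
  have "inversions p (A \<union> A') B = inversions p A B \<union> inversions p A' B"
    by (auto simp: inversions_def)
  moreover have "inversions p A B \<inter> inversions p A' B = {}"
    using assms(4) by (auto simp: inversions_def)
  ultimately show ?thesis
    using assms by (simp add: card_Un_disjoint finite_inversions)
qed

lemma card_inversions_Un_right:
  assumes "finite A" "finite B" "finite B'" "B \<inter> B' = {}"
  shows "card (inversions p A (B \<union> B')) = card (inversions p A B) + card (inversions p A B')"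
proof -
  have "inversions p A (B \<union> B') = inversions p A B \<union> inversions p A B'"
    by (auto simp: inversions_def)
  moreover have "inversions p A B \<inter> inversions p A B' = {}"
    using assms(4) by (auto simp: inversions_def)
  ultimately show ?thesis
    using assms by (simp add: card_Un_disjoint finite_inversions)
qed

lemma inversions_empty_iff:
  assumes "inj_on p A"
  shows "inversions p A A = {} \<longleftrightarrow> strict_mono_on A p"
proof
  assume e: "inversions p A A = {}"
  show "strict_mono_on A p"
  proof (rule strict_mono_onI)
    fix x y assume xy: "x \<in> A" "y \<in> A" "x < y"
    then have "\<not> p y < p x" using e by (auto simp: inversions_def)
    moreover have "p x \<noteq> p y" using xy assms by (auto dest: inj_onD)
    ultimately show "p x < p y" by simp
  qed
qed (auto simp: inversions_def dest: strict_mono_onD)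

section \<open>Excedances and \<open>dexc\<close>\<close>

lemma permutes_interval_bounds:
  assumes "p permutes {1..n::nat}" "i \<in> {1..n}"
  shows "1 \<le> p i" "p i \<le> n"
  using permutes_in_image[OF assms(1), of i] assms(2) by auto

text \<open>Position \<open>n\<close> is never an excedance because no value exceeds
  \<open>n\<close>.\<close>

lemma excedances_altdef:
  assumes "p permutes {1..n}"
  shows "excedances n p = {i \<in> {1..n}. p i > i}"
proof -
  have "i \<in> {1..n - 1}" if "i \<in> {1..n}" "p i > i" for i
    using that permutes_interval_bounds(2)[OF assms that(1)] by auto
  then show ?thesis
    by (auto simp: excedances_def)
qed

lemma finite_excedances: "finite (excedances n p)"
  by (simp add: excedances_def)

text \<open>The additive form keeps truncated subtraction out of later sums.\<close>

lemma dexc_plus_sum: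
  "dexc n p + \<Sum>(excedances n p) = (\<Sum>i\<in>excedances n p. p i)"
  unfolding dexc_def sum.distrib[symmetric]
  by (rule sum.cong) (auto simp: excedances_def)

text \<open>There are \<open>p i - 1\<close> smaller values and \<open>i - 1\<close> earlier
  positions. The earlier positions with smaller value (\<open>?C\<close>) occur in both counts;
  cancelling them leaves the inversions to the right and to the left of \<open>i\<close>.\<close>

lemma right_minus_left_inversions:
  assumes p: "p permutes {1..n}" and i: "i \<in> {1..n}"
  shows "card {j \<in> {1..n}. i < j \<and> p j < p i} + i = card {j \<in> {1..n}. j < i \<and> p i < p j} + p i"
proof -
  let ?R = "{j \<in> {1..n}. i < j \<and> p j < p i}"
  let ?L = "{j \<in> {1..n}. j < i \<and> p i < p j}"
  let ?C = "{j \<in> {1..n}. j < i \<and> p j < p i}"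
  have inj: "inj_on p T" for T
    using permutes_inj[OF p] by (rule inj_on_subset) simp
  have neq: "p j \<noteq> p i" if "j \<noteq> i" for j
    using inj[of UNIV] that by (auto dest: inj_onD)
  have "{1..<p i} = p ` {j \<in> {1..n}. p j < p i}"
  proof (intro equalityI subsetI)
    fix y assume y: "y \<in> {1..<p i}"
    then have "y \<in> {1..n}"
      using permutes_interval_bounds[OF p i] by auto
    then obtain j where "j \<in> {1..n}" "y = p j"
      using permutes_image[OF p] by (metis imageE)
    then show "y \<in> p ` {j \<in> {1..n}. p j < p i}"
      using y by auto
  qed (use permutes_interval_bounds[OF p] in auto)
  then have "p i - 1 = card {j \<in> {1..n}. p j < p i}"
    using card_image[OF inj, of "{j \<in> {1..n}. p j < p i}"] by (metis card_atLeastLessThan)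
  also have "{j \<in> {1..n}. p j < p i} = ?C \<union> ?R"
    by (auto simp: not_less_iff_gr_or_eq)
  also have "card \<dots> = card ?C + card ?R"
    by (rule card_Un_disjoint) auto
  finally have 1: "p i - 1 = card ?C + card ?R" .
  have "i - 1 = card {1..<i}"
    by simp
  also have "{1..<i} = ?C \<union> ?L"
    using i neq by (auto simp: not_less order_le_less) 
  also have "card \<dots> = card ?C + card ?L"
    by (rule card_Un_disjoint) auto
  finally have 2: "i - 1 = card ?C + card ?L" .
  show ?thesis
    using 1 2 i permutes_interval_bounds[OF p i] by auto
qed

text \<open>
  Summing \<open>right_minus_left_inversions\<close> over the set \<open>E\<close> of excedances compares the inversions with
  left end in \<open>E\<close> with those with right end in \<open>E\<close>; inversions inside \<open>E\<close> cancel.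
\<close>

lemma dexc_eq_card_inversions:
  assumes p: "p permutes {1..n}"
  shows "dexc n p = card (inversions p (excedances n p) ({1..n} - excedances n p))"
    and "inversions p ({1..n} - excedances n p) (excedances n p) = {}"
proof -
  let ?E = "excedances n p" and ?N = "{1..n} - excedances n p"
  have E: "?E \<subseteq> {1..n}" "finite ?E"
    by (auto simp: excedances_altdef[OF p])
  have S: "{1..n} = ?E \<union> ?N"
    using E by auto
  \<comment> \<open>An excedance \<open>j\<close> and a non-excedance \<open>i < j\<close> satisfy
    \<open>p i \<le> i < j < p j\<close>.\<close>
  show NE: "inversions p ?N ?E = {}"
    by (auto simp: inversions_def excedances_altdef[OF p])
  let ?R = "\<lambda>i. {j \<in> {1..n}. i < j \<and> p j < p i}"
  let ?L = "\<lambda>i. {j \<in> {1..n}. j < i \<and> p i < p j}"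
  have "card (inversions p ?E {1..n}) = card (SIGMA i:?E. ?R i)"
    by (rule arg_cong[where f = card]) (auto simp: inversions_def)
  also have "\<dots> = (\<Sum>i\<in>?E. card (?R i))"
    using E by (simp add: card_SigmaI)
  finally have R: "card (inversions p ?E {1..n}) = (\<Sum>i\<in>?E. card (?R i))" .
  \<comment> \<open>These inversions are grouped by their right end, hence the swap.\<close>
  have "bij_betw prod.swap (inversions p {1..n} ?E) (SIGMA i:?E. ?L i)"
    by (rule bij_betwI[where g = prod.swap]) (auto simp: inversions_def)
  then have "card (inversions p {1..n} ?E) = card (SIGMA i:?E. ?L i)"
    by (rule bij_betw_same_card)
  also have "\<dots> = (\<Sum>i\<in>?E. card (?L i))"
    using E by (simp add: card_SigmaI)
  finally have L: "card (inversions p {1..n} ?E) = (\<Sum>i\<in>?E. card (?L i))" .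
  have "(\<Sum>i\<in>?E. card (?R i)) + \<Sum>?E = (\<Sum>i\<in>?E. card (?R i) + i)"
    by (simp add: sum.distrib)
  also have "\<dots> = (\<Sum>i\<in>?E. card (?L i) + p i)"
    by (rule sum.cong) (use right_minus_left_inversions[OF p] E in auto)
  also have "\<dots> = (\<Sum>i\<in>?E. card (?L i)) + (dexc n p + \<Sum>?E)"
    by (simp add: sum.distrib dexc_plus_sum)
  finally have "card (inversions p ?E {1..n}) = card (inversions p {1..n} ?E) + dexc n p"
    unfolding R L by simp
  moreover have "card (inversions p ?E {1..n}) = card (inversions p ?E ?E) + card (inversions p ?E ?N)"
    by (subst S, rule card_inversions_Un_right) (use E in auto)
  moreover have "card (inversions p {1..n} ?E) = card (inversions p ?E ?E) + card (inversions p ?N ?E)"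
    by (subst S, rule card_inversions_Un_left) (use E in auto)
  ultimately show "dexc n p = card (inversions p ?E ?N)"
    using NE by simp
qed

text \<open>Of the four blocks of inversions the mixed ones contribute \<open>dexc n p\<close> and
  \<open>0\<close>, so equality with \<open>dexc n p\<close> says that the two pure blocks are
  empty.\<close>

lemma bi_increasing_iff_strict_mono_on:
  assumes p: "p permutes {1..n}"
  shows "bi_increasing n p \<longleftrightarrow>
    strict_mono_on (excedances n p) p \<and> strict_mono_on ({1..n} - excedances n p) p"
proof -
  let ?E = "excedances n p" and ?N = "{1..n} - excedances n p"
  have E: "?E \<subseteq> {1..n}" "finite ?E"
    by (auto simp: excedances_altdef[OF p])
  have S: "{1..n} = ?E \<union> ?N"
    using E by auto
  have inj: "inj_on p T" for T
    using permutes_inj[OF p] by (rule inj_on_subset) simp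
  have "inversion_number n p = card (inversions p {1..n} {1..n})"
    by (simp add: inversion_number_def inversions_def)
  also have "\<dots> = card (inversions p ?E {1..n}) + card (inversions p ?N {1..n})"
    by (subst S, rule card_inversions_Un_left) (use E in auto)
  also have "card (inversions p ?E {1..n}) = card (inversions p ?E ?E) + card (inversions p ?E ?N)"
    by (subst S, rule card_inversions_Un_right) (use E in auto)
  also have "card (inversions p ?N {1..n}) = card (inversions p ?N ?E) + card (inversions p ?N ?N)"
    by (subst S, rule card_inversions_Un_right) (use E in auto)
  finally have "inversion_number n p =
      dexc n p + card (inversions p ?E ?E) + card (inversions p ?N ?N)"
    using dexc_eq_card_inversions[OF p] by simp
  then have "bi_increasing n p \<longleftrightarrow> inversions p ?E ?E = {} \<and> inversions p ?N ?N = {}"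
    using E by (simp add: bi_increasing_def finite_inversions)
  then show ?thesis
    by (simp add: inversions_empty_iff inj)
qed

text \<open>
  \<open>A\<close> and \<open>B\<close> are the times of the East steps of the upper and of the lower path; at every time
  strictly between the end points the lower path lies strictly to the right of the upper one.
\<close>

definition east_times :: "nat \<Rightarrow> nat \<Rightarrow> (nat set \<times> nat set) set" where
  "east_times n e = {(A, B). A \<subseteq> {1..n + 1} \<and> B \<subseteq> {1..n + 1} \<and> card A = e + 1 \<and> card B = e + 1 \<and>
    (\<forall>t\<in>{1..n}. card (A \<inter> {..t}) < card (B \<inter> {..t}))}"

section \<open>Pairs of time sets and their forced first and last elements\<close>

text \<open>At time \<open>1\<close> the upper count lies below a lower count of at most one. At
  time \<open>n\<close> it still lies below, yet both totals are \<open>e + 1\<close>, so the last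
  step is East on the upper path only.\<close>

lemma east_times_ends:
  assumes "(A, B) \<in> east_times n e" "n \<ge> 1"
  shows "1 \<notin> A" "1 \<in> B" "n + 1 \<in> A" "n + 1 \<notin> B"
proof -
  have AB: "A \<subseteq> {1..n + 1}" "B \<subseteq> {1..n + 1}" "card A = e + 1" "card B = e + 1"
    and dom: "\<And>t. t \<in> {1..n} \<Longrightarrow> card (A \<inter> {..t}) < card (B \<inter> {..t})"
    using assms(1) by (auto simp: east_times_def)
  have first: "S \<inter> {..1} = (if 1 \<in> S then {1} else {})" if "S \<subseteq> {1..n + 1}" for S :: "nat set"
    using that by (auto simp: le_Suc_eq)
  show "1 \<notin> A" "1 \<in> B"
    using dom[of 1] assms(2) first[OF AB(1)] first[OF AB(2)] by (auto split: if_splits)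
  have last: "card S = card (S \<inter> {..n}) + (if n + 1 \<in> S then 1 else 0)" if "S \<subseteq> {1..n + 1}" for S
  proof -
    have fS: "finite S" using that by (rule finite_subset) simp
    have "S = (S \<inter> {..n}) \<union> (S \<inter> {n + 1})"
      using that by (auto simp: le_Suc_eq)
    then have "card S = card ((S \<inter> {..n}) \<union> (S \<inter> {n + 1}))"
      by simp
    also have "\<dots> = card (S \<inter> {..n}) + card (S \<inter> {n + 1})"
      by (rule card_Un_disjoint) (use fS in auto)
    finally have "card S = card (S \<inter> {..n}) + card (S \<inter> {n + 1})" .
    then show ?thesis by auto
  qed
  show "n + 1 \<in> A" "n + 1 \<notin> B"
    using dom[of n] assms(2) last[OF AB(1)] last[OF AB(2)] AB(3,4) by (auto split: if_splits)
qed

text \<open>The forced element \<open>1\<close> adds one to every lower count, while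
  \<open>n + 1\<close> adds nothing up to time \<open>n\<close>; so the strict comparison becomes a
  weak one. Shifting \<open>I\<close> by \<open>Suc\<close> turns \<open>{..t}\<close> into
  \<open>{..<t}\<close>.\<close>

lemma east_times_shift_iff:
  assumes I: "I \<subseteq> {1..<n}" and J: "J \<subseteq> {2..n}"
  shows "(insert (n + 1) J, insert 1 (Suc ` I)) \<in> east_times n e \<longleftrightarrow>
    card I = e \<and> card J = e \<and> (\<forall>t\<in>{1..n}. card (J \<inter> {..t}) \<le> card (I \<inter> {..<t}))"
proof -
  have fin: "finite I" "finite J"
    using I J by (auto intro: finite_subset)
  have "card (insert (n + 1) J) = card J + 1"
    using fin J by (subst card_insert_disjoint) auto
  moreover have "card (insert 1 (Suc ` I)) = card I + 1"
    using fin I by (subst card_insert_disjoint) (auto simp: card_image)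
  moreover have "card (insert (n + 1) J \<inter> {..t}) = card (J \<inter> {..t})" if "t \<in> {1..n}" for t
    using that by (simp add: Int_insert_left)
  moreover have "card (insert 1 (Suc ` I) \<inter> {..t}) = card (I \<inter> {..<t}) + 1" if "t \<in> {1..n}" for t
  proof -
    have "insert 1 (Suc ` I) \<inter> {..t} = insert 1 (Suc ` (I \<inter> {..<t}))"
      using that by auto
    also have "card \<dots> = card (I \<inter> {..<t}) + 1"
      using fin I by (subst card_insert_disjoint) (auto simp: card_image)
    finally show ?thesis .
  qed
  moreover have "insert (n + 1) J \<subseteq> {1..n + 1}" "insert 1 (Suc ` I) \<subseteq> {1..n + 1}"
    using I J by auto
  ultimately show ?thesis
    by (auto simp: east_times_def less_Suc_eq_le)
qed

lemma east_times_cases: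
  assumes "(A, B) \<in> east_times n e" "n \<ge> 1"
  obtains I J where "I \<subseteq> {1..<n}" "J \<subseteq> {2..n}" "A = insert (n + 1) J" "B = insert 1 (Suc ` I)"
proof
  have AB: "A \<subseteq> {1..n + 1}" "B \<subseteq> {1..n + 1}"
    using assms(1) by (auto simp: east_times_def)
  note ends = east_times_ends[OF assms]
  have A: "2 \<le> x \<and> x \<le> n" if "x \<in> A" "x \<noteq> n + 1" for x
  proof -
    have "x \<noteq> 1" using that ends by blast
    then show ?thesis using that AB by force
  qed
  have B: "2 \<le> x \<and> x \<le> n" if "x \<in> B" "x \<noteq> 1" for x
  proof -
    have "x \<noteq> n + 1" using that ends by blast
    then show ?thesis using that AB by force
  qed
  \<comment> \<open>The witnesses: \<open>J\<close> is \<open>A\<close> without its forced last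
    time, \<open>I\<close> is \<open>B\<close> without its forced first time, shifted down by
    one.\<close>
  show "A - {n + 1} \<subseteq> {2..n}"
    using A by (metis DiffE atLeastAtMost_iff singletonI subsetI)
  show "A = insert (n + 1) (A - {n + 1})"
    using ends by auto
  show "(\<lambda>x. x - 1) ` (B - {1}) \<subseteq> {1..<n}"
    using B by fastforce
  \<comment> \<open>The remaining elements of \<open>B\<close> are at least \<open>2\<close>, so
    \<open>x - 1\<close> is not truncated and \<open>Suc\<close> undoes it.\<close>
  have "Suc ` (\<lambda>x. x - 1) ` (B - {1}) = (\<lambda>x. x) ` (B - {1})"
    unfolding image_image using B by (intro image_cong) fastforce+
  then show "B = insert 1 (Suc ` (\<lambda>x. x - 1) ` (B - {1}))"
    using ends by auto
qed

section \<open>From bi-increasing permutations to pairs of time sets\<close>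

definition permutation_east_times :: "nat \<Rightarrow> (nat \<Rightarrow> nat) \<Rightarrow> nat set \<times> nat set" where
  "permutation_east_times n p =
    (insert (n + 1) (p ` excedances n p), insert 1 (Suc ` excedances n p))"

lemma excedances_bounds:
  assumes "p permutes {1..n}"
  shows "excedances n p \<subseteq> {1..<n}" "p ` excedances n p \<subseteq> {2..n}"
  using permutes_interval_bounds[OF assms] by (fastforce simp: excedances_def)+

text \<open>The counting condition holds because an excedance value at most \<open>t\<close> sits at
  a position below \<open>t\<close>.\<close>

lemma permutation_east_times_in:
  assumes p: "p permutes {1..n}"
  shows "permutation_east_times n p \<in> east_times n (exc n p)"
proof -
  let ?E = "excedances n p"
  have inj: "inj_on p T" for T
    using permutes_inj[OF p] by (rule inj_on_subset) simp
  have "card (p ` ?E \<inter> {..t}) \<le> card (?E \<inter> {..<t})" for t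
  proof -
    have "p ` ?E \<inter> {..t} \<subseteq> p ` (?E \<inter> {..<t})"
      by (auto simp: excedances_def)
    then show ?thesis
      using finite_excedances by (meson card_image_le card_mono finite_Int finite_imageI le_trans)
  qed
  moreover have "card (p ` ?E) = card ?E"
    using inj by (rule card_image)
  ultimately show ?thesis
    unfolding permutation_east_times_def east_times_shift_iff[OF excedances_bounds[OF p]]
    by (simp add: exc_def)
qed

text \<open>The sum of the excedances occurs on both sides and cancels. What remains is
  \<open>n + 1 + dexc n p\<close> for the upper times and \<open>1 + exc n p\<close> for the lower
  ones.\<close>

lemma permutation_east_times_sum:
  assumes p: "p permutes {1..n}" and n: "n \<ge> 1"
  shows "int (\<Sum>(fst (permutation_east_times n p))) - int (\<Sum>(snd (permutation_east_times n p))) =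
    int n + int (dexc n p) - int (exc n p)"
proof -
  let ?E = "excedances n p"
  have inj: "inj_on p T" for T
    using permutes_inj[OF p] by (rule inj_on_subset) simp
  note b = excedances_bounds[OF p]
  have "\<Sum>(insert (n + 1) (p ` ?E)) = n + 1 + \<Sum>(p ` ?E)"
    using b(2) finite_excedances by (subst sum.insert) auto
  also have "\<Sum>(p ` ?E) = (\<Sum>i\<in>?E. p i)"
    using inj by (simp add: sum.reindex)
  finally have 1: "\<Sum>(insert (n + 1) (p ` ?E)) = n + 1 + dexc n p + \<Sum>?E"
    by (simp add: dexc_plus_sum)
  have "\<Sum>(insert 1 (Suc ` ?E)) = 1 + \<Sum>(Suc ` ?E)"
    using b(1) finite_excedances by (subst sum.insert) auto
  also have "\<Sum>(Suc ` ?E) = (\<Sum>i\<in>?E. i + 1)"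
    by (simp add: sum.reindex)
  finally have 2: "\<Sum>(insert 1 (Suc ` ?E)) = 1 + exc n p + \<Sum>?E"
    by (simp only: sum.distrib) (simp add: exc_def)
  show ?thesis
    using 1 2 by (simp add: permutation_east_times_def)
qed

text \<open>Removing the forced elements recovers the excedance positions and values; an increasing
  map is determined by its domain and image, on the excedances and on their complement
  alike.\<close>

lemma permutation_east_times_inj:
  "inj_on (permutation_east_times n) {p. p permutes {1..n} \<and> bi_increasing n p}"
proof (rule inj_onI, clarsimp)
  fix p q assume p: "p permutes {Suc 0..n}" "bi_increasing n p"
    and q: "q permutes {Suc 0..n}" "bi_increasing n q"
    and eq: "permutation_east_times n p = permutation_east_times n q"
  let ?E = "excedances n p"
  have p': "p permutes {1..n}" and q': "q permutes {1..n}"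
    using p q by auto
  have injs: "inj_on r {1..n}" if "r permutes {1..n}" for r
    using permutes_inj[OF that] by (rule inj_on_subset) simp
  note bp = excedances_bounds[OF p'] and bq = excedances_bounds[OF q']
  have "insert 1 (Suc ` ?E) = insert 1 (Suc ` excedances n q)"
    and J: "insert (n + 1) (p ` ?E) = insert (n + 1) (q ` excedances n q)"
    using eq by (auto simp: permutation_east_times_def)
  moreover have "1 \<notin> Suc ` ?E" "1 \<notin> Suc ` excedances n q"
    using bp(1) bq(1) by auto
  ultimately have "Suc ` ?E = Suc ` excedances n q"
    by (metis insert_ident)
  then have E: "excedances n q = ?E"
    by (metis inj_image_eq_iff inj_Suc)
  have "n + 1 \<notin> p ` ?E" "n + 1 \<notin> q ` ?E"
    using bp(2) bq(2) E by auto
  then have imE: "p ` ?E = q ` ?E"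
    using J unfolding E by (metis insert_ident)
  have sub: "?E \<subseteq> {1..n}"
    using bp(1) by auto
  \<comment> \<open>Both permutations map \<open>{1..n}\<close> onto itself, so equal images of
    \<open>?E\<close> give equal images of its complement.\<close>
  have imN: "p ` ({1..n} - ?E) = q ` ({1..n} - ?E)"
    using inj_on_image_set_diff[OF injs[OF p'] _ sub, of "{1..n}"]
      inj_on_image_set_diff[OF injs[OF q'] _ sub, of "{1..n}"]
      permutes_image[OF p'] permutes_image[OF q'] imE by simp
  have m: "strict_mono_on ?E p" "strict_mono_on ({1..n} - ?E) p"
    "strict_mono_on ?E q" "strict_mono_on ({1..n} - ?E) q"
    using p(2) q(2) bi_increasing_iff_strict_mono_on[OF p'] bi_increasing_iff_strict_mono_on[OF q'] E
    by auto
  show "p = q"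
  proof
    fix i
    consider "i \<in> ?E" | "i \<in> {1..n} - ?E" | "i \<notin> {1..n}"
      by blast
    then show "p i = q i"
    proof cases
      case 1
      then show ?thesis by (rule strict_mono_on_unique[OF m(1,3) imE])
    next
      case 2
      then show ?thesis by (rule strict_mono_on_unique[OF m(2,4) imN])
    next
      case 3
      then show ?thesis using p' q' by (simp add: permutes_not_in)
    qed
  qed
qed

text \<open>The permutation maps \<open>I\<close> onto \<open>J\<close> and the complement of
  \<open>I\<close> onto that of \<open>J\<close>, both increasingly. The counting condition then
  makes \<open>I\<close> exactly the set of excedances.\<close>

lemma ex_bi_increasing:
  assumes I: "I \<subseteq> {1..<n}" and J: "J \<subseteq> {2..n}" and cIJ: "card I = card J"
    and dom: "\<And>t. t \<in> {1..n} \<Longrightarrow> card (J \<inter> {..t}) \<le> card (I \<inter> {..<t})"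
  shows "\<exists>p. p permutes {1..n} \<and> bi_increasing n p \<and> excedances n p = I \<and> p ` I = J"
proof -
  let ?I' = "{1..n} - I" and ?J' = "{1..n} - J"
  have IJ: "I \<subseteq> {1..n}" "J \<subseteq> {1..n}"
    using I J by auto
  have fin: "finite I" "finite J"
    using I J by (auto intro: finite_subset)
  have "card ?I' = card ?J'"
    using IJ fin cIJ by (simp add: card_Diff_subset)
  then obtain g' where g': "bij_betw g' ?I' ?J'" "strict_mono_on ?I' g'"
    using ex_strict_mono_on_bij_betw[of ?I' ?J'] by auto
  obtain g where g: "bij_betw g I J" "strict_mono_on I g"
    using ex_strict_mono_on_bij_betw[OF fin cIJ] by auto
  define p where "p i = (if i \<in> I then g i else if i \<in> {1..n} then g' i else i)" for i
  have im: "p ` I = J" "p ` ?I' = ?J'"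
    using g(1) g'(1) by (auto simp: p_def bij_betw_def image_def)
  have mono: "strict_mono_on I p" "strict_mono_on ?I' p"
    using g(2) g'(2) by (auto simp: p_def strict_mono_on_def)
  have "bij_betw p I J" "bij_betw p ?I' ?J'"
    using im mono by (auto simp: bij_betw_def intro: strict_mono_on_imp_inj_on)
  then have "bij_betw p (I \<union> ?I') (J \<union> ?J')"
    by (rule bij_betw_combine) auto
  then have "bij_betw p {1..n} {1..n}"
    using IJ by (simp add: Un_absorb1)
  then have p: "p permutes {1..n}"
    by (rule bij_imp_permutes) (use IJ in \<open>auto simp: p_def\<close>)
  \<comment> \<open>If \<open>p i \<le> i\<close>, then \<open>J\<close> has at least as many
    elements up to \<open>i\<close> as up to \<open>p i\<close>, which by ranks is the number of
    elements of \<open>I\<close> up to \<open>i\<close>. But \<open>dom\<close> allows only as many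
    as \<open>I\<close> has strictly below \<open>i\<close>.\<close>
  have up: "i < p i" if i: "i \<in> I" for i
  proof (rule ccontr)
    assume "\<not> i < p i"
    then have "J \<inter> {..p i} \<subseteq> J \<inter> {..i}"
      by auto
    then have "card (J \<inter> {..p i}) \<le> card (J \<inter> {..i})"
      using fin by (intro card_mono) auto
    also have "\<dots> \<le> card (I \<inter> {..<i})"
      using dom i IJ by auto
    also have "\<dots> < card (I \<inter> {..i})"
      using i fin by (intro psubset_card_mono) auto
    also have "\<dots> = card (J \<inter> {..p i})"
      using card_image_below_strict_mono_on(2)[OF mono(1) i] im by simp
    finally show False by simp
  qed
  \<comment> \<open>If \<open>i < p i\<close>, then by ranks the complement of \<open>J\<close> has
    fewer elements up to \<open>i\<close> than the complement of \<open>I\<close>. Taking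
    complements in \<open>{1..i}\<close>, \<open>J\<close> has more than \<open>I\<close> there,
    against \<open>dom\<close>.\<close>
  have down: "p i \<le> i" if i: "i \<in> ?I'" for i
  proof (rule ccontr)
    assume "\<not> p i \<le> i"
    then have less: "i < p i" by simp
    have compl: "card (({1..n} - S) \<inter> {..i}) + card (S \<inter> {..i}) = i" if "S \<subseteq> {1..n}" for S
    proof -
      have fS: "finite S" using that by (rule finite_subset) simp
      have "({1..n} - S) \<inter> {..i} \<union> S \<inter> {..i} = {1..i}"
        using that i by auto
      moreover have "card (({1..n} - S) \<inter> {..i} \<union> S \<inter> {..i}) =
          card (({1..n} - S) \<inter> {..i}) + card (S \<inter> {..i})"
        using fS by (intro card_Un_disjoint) auto
      ultimately show ?thesis by simp
    qed
    have "p i \<in> ?J'"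
      using im(2) i by blast
    then have "p i \<in> ?J' \<inter> {..p i}" "p i \<notin> ?J' \<inter> {..i}"
      using less by auto
    moreover have "?J' \<inter> {..i} \<subseteq> ?J' \<inter> {..p i}"
      using less by auto
    ultimately have "?J' \<inter> {..i} \<subset> ?J' \<inter> {..p i}"
      by blast
    then have "card (?J' \<inter> {..i}) < card (?J' \<inter> {..p i})"
      by (intro psubset_card_mono) auto
    also have "\<dots> = card (?I' \<inter> {..i})"
      using card_image_below_strict_mono_on(2)[OF mono(2) i] im by simp
    finally have "card (I \<inter> {..i}) < card (J \<inter> {..i})"
      using compl[OF IJ(1)] compl[OF IJ(2)] by simp
    also have "\<dots> \<le> card (I \<inter> {..<i})"
      using dom i by auto
    also have "\<dots> \<le> card (I \<inter> {..i})"
      using fin by (intro card_mono) auto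
    finally show False by simp
  qed
  have E: "excedances n p = I"
    using up down IJ unfolding excedances_altdef[OF p] by (auto simp: not_le[symmetric])
  then have "bi_increasing n p"
    using mono bi_increasing_iff_strict_mono_on[OF p] by simp
  then show ?thesis
    using p E im by blast
qed

lemma bij_betw_permutation_east_times:
  assumes n: "n \<ge> 1"
  shows "bij_betw (permutation_east_times n)
    {p. p permutes {1..n} \<and> bi_increasing n p \<and> exc n p = e \<and> dexc n p = k}
    {(A, B) \<in> east_times n e. int (\<Sum>A) - int (\<Sum>B) = int n + int k - int e}"
    (is "bij_betw ?f ?S ?T")
proof (rule bij_betw_imageI)
  show "inj_on ?f ?S"
    by (rule inj_on_subset[OF permutation_east_times_inj]) auto
  show "?f ` ?S = ?T"
  proof (intro equalityI subsetI)
    fix ab assume "ab \<in> ?f ` ?S"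
    then show "ab \<in> ?T"
      using permutation_east_times_in[of _ n] permutation_east_times_sum[of _ n, OF _ n] by fastforce
  next
    fix ab assume "ab \<in> ?T"
    then obtain A B where ab: "ab = (A, B)" "(A, B) \<in> east_times n e"
      "int (\<Sum>A) - int (\<Sum>B) = int n + int k - int e"
      by auto
    obtain I J where IJ: "I \<subseteq> {1..<n}" "J \<subseteq> {2..n}" "A = insert (n + 1) J" "B = insert 1 (Suc ` I)"
      using east_times_cases[OF ab(2) n] .
    have "card I = e" "card J = e"
      and "\<And>t. t \<in> {1..n} \<Longrightarrow> card (J \<inter> {..t}) \<le> card (I \<inter> {..<t})"
      using ab(2) unfolding IJ(3,4) east_times_shift_iff[OF IJ(1,2)] by auto
    then obtain p where p: "p permutes {1..n}" "bi_increasing n p" "excedances n p = I" "p ` I = J"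
      using ex_bi_increasing[OF IJ(1,2)] by metis
    have f: "?f p = ab"
      by (simp add: permutation_east_times_def p ab IJ)
    have "exc n p = e"
      using p \<open>card I = e\<close> by (simp add: exc_def)
    \<comment> \<open>With \<open>exc n p = e\<close> known, the difference of the two sums
      determines \<open>dexc n p\<close>.\<close>
    moreover from this have "dexc n p = k"
      using permutation_east_times_sum[OF p(1) n] ab by (simp add: f)
    ultimately show "ab \<in> ?f ` ?S"
      using p f by blast
  qed
qed

subsection \<open>Lattice paths and the region between them\<close>

text \<open>The abscissa after \<open>t\<close> steps. \<open>nat\<close> cuts negative times to
  \<open>0\<close>; thus, for finite \<open>A\<close> with \<open>0 \<notin> A\<close>, the path
  extends to all integer times, with North steps before its start and after its last East
  step.\<close>

definition easts :: "nat set \<Rightarrow> int \<Rightarrow> int" where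
  "easts A t = int (card (A \<inter> {..nat t}))"

text \<open>Every unit step raises the coordinate sum by one, so a vertex reveals its time.\<close>

definition path_vertex :: "nat set \<Rightarrow> int \<Rightarrow> point" where
  "path_vertex A t = (easts A t, t - easts A t)"

text \<open>The edge that leaves the vertex of time \<open>t\<close> is step number
  \<open>t + 1\<close>.\<close>

definition path_edge :: "nat set \<Rightarrow> int \<Rightarrow> edge" where
  "path_edge A t = (path_vertex A t, if nat (t + 1) \<in> A then East else North)"

lemma easts_int: "easts A (int t) = int (card (A \<inter> {..t}))"
  by (simp add: easts_def)

lemma easts_plus_one:
  assumes "0 \<notin> A"
  shows "easts A (t + 1) = easts A t + (if nat (t + 1) \<in> A then 1 else 0)"
proof (cases "t < 0")
  case True
  then show ?thesis using assms by (simp add: easts_def)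
next
  case False
  then show ?thesis
    by (simp add: easts_def nat_add_distrib atMost_Suc Int_insert_right)
qed

lemma easts_nonpos:
  assumes "0 \<notin> A" "t \<le> 0"
  shows "easts A t = 0"
  using assms by (simp add: easts_def)

lemma easts_beyond:
  assumes "A \<subseteq> {1..m}" "int m \<le> t"
  shows "easts A t = int (card A)"
proof -
  have "{1..m} \<subseteq> {..nat t}"
    using assms(2) by auto
  then have "A \<inter> {..nat t} = A"
    using assms(1) by blast
  then show ?thesis by (simp add: easts_def)
qed

lemma easts_cong:
  assumes "\<And>i. int i \<le> t \<Longrightarrow> 0 < i \<Longrightarrow> i \<in> A \<longleftrightarrow> i \<in> B" "0 \<notin> A" "0 \<notin> B"
  shows "easts A t = easts B t"
proof -
  have "i \<in> A \<longleftrightarrow> i \<in> B" if "i \<le> nat t" for i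
    using that assms by (cases "i = 0") auto
  then have "A \<inter> {..nat t} = B \<inter> {..nat t}"
    by auto
  then show ?thesis by (simp add: easts_def)
qed

lemma path_vertex_inj: "inj_on (path_vertex A) S"
  by (rule inj_onI) (simp add: path_vertex_def)

lemma path_edge_inj: "inj_on (path_edge A) S"
  using path_vertex_inj[of A S] by (auto simp: inj_on_def path_edge_def)

section \<open>Step lists and their East times\<close>

definition list_east_times :: "step list \<Rightarrow> nat set" where
  "list_east_times ss = {t \<in> {1..length ss}. ss ! (t - 1) = East}"

lemma list_east_times_subset: "list_east_times ss \<subseteq> {1..length ss}"
  by (auto simp: list_east_times_def)

lemma zero_notin_list_east_times [simp]: "0 \<notin> list_east_times ss"
  by (simp add: list_east_times_def)

lemma list_east_times_snoc:
  "list_east_times (ss @ [s]) =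
    list_east_times ss \<union> (if s = East then {Suc (length ss)} else {})"
  by (auto simp: list_east_times_def nth_append le_Suc_eq split: if_splits)

lemma ex_list_east_times:
  assumes "A \<subseteq> {1..m}"
  shows "\<exists>ss. length ss = m \<and> list_east_times ss = A"
proof (intro exI conjI)
  let ?ss = "map (\<lambda>t. if Suc t \<in> A then East else North) [0..<m]"
  show "length ?ss = m" by simp
  have "?ss ! (t - 1) = East \<longleftrightarrow> t \<in> A" if "t \<in> {1..m}" for t
    using that by (auto split: if_splits)
  then show "list_east_times ?ss = A"
    using assms by (auto simp: list_east_times_def)
qed

lemma path_end_snoc: "path_end q (ss @ [s]) = path_end q ss + step_vec s"
  by (induction ss arbitrary: q) auto

lemma path_edges_snoc: "path_edges q (ss @ [s]) = insert (path_end q ss, s) (path_edges q ss)"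
  by (induction ss arbitrary: q) auto

lemma path_vertices_snoc:
  "path_vertices q (ss @ [s]) = insert (path_end q ss + step_vec s) (path_vertices q ss)"
  by (induction ss arbitrary: q) auto

lemma easts_snoc:
  assumes "t \<le> int (length ss)"
  shows "easts (list_east_times (ss @ [s])) t = easts (list_east_times ss) t"
  by (rule easts_cong) (use assms in \<open>auto simp: list_east_times_snoc\<close>)

lemma path_vertex_snoc:
  assumes "t \<le> int (length ss)"
  shows "path_vertex (list_east_times (ss @ [s])) t = path_vertex (list_east_times ss) t"
  using easts_snoc[OF assms] by (simp add: path_vertex_def)

lemma path_edge_snoc:
  assumes "t < int (length ss)"
  shows "path_edge (list_east_times (ss @ [s])) t = path_edge (list_east_times ss) t"
proof -
  have "nat (t + 1) \<in> list_east_times (ss @ [s]) \<longleftrightarrow> nat (t + 1) \<in> list_east_times ss"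
    using assms by (auto simp: list_east_times_snoc)
  then show ?thesis
    using assms by (simp add: path_edge_def path_vertex_snoc)
qed

lemma path_edge_snoc_last:
  "path_edge (list_east_times (ss @ [s])) (int (length ss)) =
    (path_vertex (list_east_times ss) (int (length ss)), s)"
proof -
  have "nat (int (length ss) + 1) = Suc (length ss)" by simp
  moreover have "Suc (length ss) \<in> list_east_times (ss @ [s]) \<longleftrightarrow> s = East"
    using list_east_times_subset[of ss] by (auto simp: list_east_times_snoc)
  ultimately show ?thesis
    by (cases s) (simp_all add: path_edge_def path_vertex_snoc)
qed

lemma path_vertex_snoc_last:
  "path_vertex (list_east_times (ss @ [s])) (int (length ss) + 1) =
    path_vertex (list_east_times ss) (int (length ss)) + step_vec s"
proof -
  have "nat (int (length ss) + 1) = Suc (length ss)" by simp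
  moreover have "Suc (length ss) \<in> list_east_times (ss @ [s]) \<longleftrightarrow> s = East"
    using list_east_times_subset[of ss] by (auto simp: list_east_times_snoc)
  moreover have "easts (list_east_times (ss @ [s])) (int (length ss)) =
      easts (list_east_times ss) (int (length ss))"
    by (rule easts_snoc) simp
  ultimately show ?thesis
    by (cases s) (simp_all add: path_vertex_def easts_plus_one)
qed

text \<open>This and the next two lemmas replace the recursive path functions by time-indexed ones.
  The induction appends steps at the end, which leaves all earlier times unchanged.\<close>

lemma path_end_eq: "path_end (0, 0) ss = path_vertex (list_east_times ss) (int (length ss))"
proof (induction ss rule: rev_induct)
  case Nil
  then show ?case by (simp add: path_vertex_def easts_nonpos)
next
  case (snoc s ss)
  then show ?case
    using path_vertex_snoc_last[of ss s] by (simp add: path_end_snoc add.commute)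
qed

lemma path_vertices_eq:
  "path_vertices (0, 0) ss = path_vertex (list_east_times ss) ` {0..int (length ss)}"
proof (induction ss rule: rev_induct)
  case Nil
  then show ?case by (simp add: path_vertex_def easts_nonpos)
next
  case (snoc s ss)
  have "{0..int (length (ss @ [s]))} = insert (int (length ss) + 1) {0..int (length ss)}"
    by auto
  moreover have "path_vertex (list_east_times (ss @ [s])) ` {0..int (length ss)} =
      path_vertex (list_east_times ss) ` {0..int (length ss)}"
    by (rule image_cong) (auto simp: path_vertex_snoc)
  ultimately show ?case
    using snoc by (simp add: path_vertices_snoc path_vertex_snoc_last path_end_eq)
qed

lemma path_edges_eq:
  "path_edges (0, 0) ss = path_edge (list_east_times ss) ` {0..<int (length ss)}"
proof (induction ss rule: rev_induct)
  case (snoc s ss)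
  have "{0..<int (length (ss @ [s]))} = insert (int (length ss)) {0..<int (length ss)}"
    by auto
  moreover have "path_edge (list_east_times (ss @ [s])) ` {0..<int (length ss)} =
      path_edge (list_east_times ss) ` {0..<int (length ss)}"
    by (rule image_cong) (auto simp: path_edge_snoc)
  ultimately show ?case
    using snoc by (simp add: path_edges_snoc path_edge_snoc_last path_end_eq)
qed simp

section \<open>Boundaries of cell sets and of regions between paths\<close>

text \<open>Turns the unique existence in \<open>boundary\<close> into an exclusive or over the two
  cells that share an edge.\<close>

lemma ex1_one_of_two:
  "a \<noteq> b \<Longrightarrow> (\<exists>!c. c \<in> P \<and> (c = a \<or> c = b)) \<longleftrightarrow> (a \<in> P) \<noteq> (b \<in> P)"
  by blast

lemma East_in_boundary:
  "((x, y), East) \<in> boundary P \<longleftrightarrow> ((x, y) \<in> P) \<noteq> ((x, y - 1) \<in> P)"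
proof -
  have c: "((x, y), East) \<in> cell_edges c \<longleftrightarrow> c = (x, y) \<or> c = (x, y - 1)" for c
    by (cases c) auto
  show ?thesis
    unfolding boundary_def mem_Collect_eq c by (rule ex1_one_of_two) simp
qed

lemma North_in_boundary:
  "((x, y), North) \<in> boundary P \<longleftrightarrow> ((x, y) \<in> P) \<noteq> ((x - 1, y) \<in> P)"
proof -
  have c: "((x, y), North) \<in> cell_edges c \<longleftrightarrow> c = (x, y) \<or> c = (x - 1, y)" for c
    by (cases c) auto
  show ?thesis
    unfolding boundary_def mem_Collect_eq c by (rule ex1_one_of_two) simp
qed

text \<open>If two sets with equal boundaries differ at a cell, they also differ at the cell below
  it, hence at infinitely many cells of that column, which finiteness excludes.\<close>

lemma boundary_inj:
  assumes "finite P" "finite Q" "boundary P = boundary Q"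
  shows "P = Q"
proof -
  let ?D = "\<lambda>x y. ((x, y) \<in> P) \<noteq> ((x, y) \<in> Q)"
  have step: "?D x (y - 1)" if "?D x y" for x y
    using that East_in_boundary[of x y P] East_in_boundary[of x y Q] assms(3) by auto
  have down: "?D x (y - int m)" if "?D x y" for x y m
  proof (induction m)
    case (Suc m)
    then show ?case using step[of x "y - int m"] by (simp add: algebra_simps)
  qed (use that in simp)
  have "\<not> ?D x y" for x y
  proof
    assume "?D x y"
    then have "(\<lambda>m. (x, y - int m)) ` UNIV \<subseteq> P \<union> Q"
      using down by auto
    then have "finite ((\<lambda>m. (x, y - int m)) ` UNIV)"
      using assms by (meson finite_UnI finite_subset)
    moreover have "inj (\<lambda>m. (x, y - int m))"
      by (rule injI) simp
    ultimately show False
      by (simp add: finite_image_iff)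
  qed
  then show ?thesis by auto
qed

text \<open>The centre of the cell \<open>(x, y)\<close> lies on the antidiagonal \<open>x + y + 1\<close>.\<close>

definition region :: "nat set \<Rightarrow> nat set \<Rightarrow> cell set" where
  "region A B = {(x, y). easts A (x + y + 1) \<le> x \<and> x < easts B (x + y + 1)}"

text \<open>An edge starting at \<open>(x, y)\<close> can only be step \<open>x + y + 1\<close> of a
  path. If just one path uses it, exactly one adjacent cell is in the region; if both do, neither
  adjacent cell is.\<close>

lemma boundary_region_iff:
  assumes "0 \<notin> A" "0 \<notin> B" "\<And>t. easts A t \<le> easts B t"
  shows "((x, y), s) \<in> boundary (region A B) \<longleftrightarrow>
    (((x, y), s) = path_edge A (x + y)) \<noteq> (((x, y), s) = path_edge B (x + y))"
proof -
  have A: "easts A (x + y + 1) = easts A (x + y) + (if nat (x + y + 1) \<in> A then 1 else 0)"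
    and B: "easts B (x + y + 1) = easts B (x + y) + (if nat (x + y + 1) \<in> B then 1 else 0)"
    using easts_plus_one assms by blast+
  have le: "easts A (x + y) \<le> easts B (x + y)" "easts A (x + y + 1) \<le> easts B (x + y + 1)"
    using assms by auto
  have edge: "((x, y), s) = path_edge C (x + y) \<longleftrightarrow>
      x = easts C (x + y) \<and> s = (if nat (x + y + 1) \<in> C then East else North)" for C
    by (auto simp: path_edge_def path_vertex_def)
  show ?thesis
  proof (cases s)
    case East
    then show ?thesis
      using A B le unfolding edge by (auto simp: East_in_boundary region_def algebra_simps split: if_splits)
  next
    case North
    then show ?thesis
      using A B le unfolding edge by (auto simp: North_in_boundary region_def algebra_simps split: if_splits)
  qed
qed

lemma east_timesD:
  assumes "(A, B) \<in> east_times n e"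
  shows "A \<subseteq> {1..n + 1}" "B \<subseteq> {1..n + 1}" "card A = e + 1" "card B = e + 1" "0 \<notin> A" "0 \<notin> B"
    and "t \<le> 0 \<or> int n + 1 \<le> t \<Longrightarrow> easts A t = easts B t"
    and "1 \<le> t \<Longrightarrow> t \<le> int n \<Longrightarrow> easts A t < easts B t"
    and "easts A t \<le> easts B t"
proof -
  show AB: "A \<subseteq> {1..n + 1}" "B \<subseteq> {1..n + 1}" "card A = e + 1" "card B = e + 1" "0 \<notin> A" "0 \<notin> B"
    using assms by (auto simp: east_times_def)
  show eq: "easts A t = easts B t" if "t \<le> 0 \<or> int n + 1 \<le> t"
    using that easts_nonpos[of A t] easts_nonpos[of B t] AB
      easts_beyond[OF AB(1), of t] easts_beyond[OF AB(2), of t] by auto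
  show less: "easts A t < easts B t" if t: "1 \<le> t" "t \<le> int n"
  proof -
    have "nat t \<in> {1..n}" using t by auto
    then show ?thesis using assms by (auto simp: east_times_def easts_def)
  qed
  show "easts A t \<le> easts B t"
    using eq less by linarith
qed

text \<open>At time \<open>0\<close> the two paths share the vertex but leave it in different
  directions; at later times the vertices themselves differ.\<close>

lemma path_edge_neq:
  assumes AB: "(A, B) \<in> east_times n e" and n: "n \<ge> 1" and t: "0 \<le> t" "t \<le> int n"
  shows "path_edge A t \<noteq> path_edge B t"
proof (cases "t = 0")
  case True
  then show ?thesis
    using east_times_ends[OF AB n] by (simp add: path_edge_def)
next
  case False
  then show ?thesis
    using east_timesD(8)[OF AB, of t] t by (simp add: path_edge_def path_vertex_def)
qed

text \<open>Outside the time range both extended paths run North through the same vertices.\<close>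

lemma path_edge_eq_iff_outside:
  assumes AB: "(A, B) \<in> east_times n e" and t: "t < 0 \<or> int n < t"
  shows "path_edge A t = path_edge B t"
proof -
  have "nat (t + 1) \<notin> A" "nat (t + 1) \<notin> B"
    using t east_timesD(1,2,5,6)[OF AB] by (force dest!: subsetD)+
  then show ?thesis
    using east_timesD(7)[OF AB, of t] t by (auto simp: path_edge_def path_vertex_def)
qed

lemma boundary_region:
  assumes AB: "(A, B) \<in> east_times n e" and n: "n \<ge> 1"
  shows "boundary (region A B) =
    path_edge A ` {0..<int (n + 1)} \<union> path_edge B ` {0..<int (n + 1)}"
proof -
  have "((x, y), s) \<in> boundary (region A B) \<longleftrightarrow>
      ((x, y), s) \<in> path_edge A ` {0..<int (n + 1)} \<union> path_edge B ` {0..<int (n + 1)}" for x y s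
  proof -
    have im: "((x, y), s) \<in> path_edge C ` {0..<int (n + 1)} \<longleftrightarrow>
        x + y \<in> {0..<int (n + 1)} \<and> ((x, y), s) = path_edge C (x + y)" for C
    proof -
      have "x + y = t" if "((x, y), s) = path_edge C t" for t
        using that by (simp add: path_edge_def path_vertex_def)
      then show ?thesis by blast
    qed
    \<comment> \<open>Inside the time range the two edges differ, so the exclusive or is a plain or;
      outside they coincide and the exclusive or fails.\<close>
    show ?thesis
      unfolding Un_iff im boundary_region_iff[OF east_timesD(5,6,9)[OF AB]]
      using path_edge_neq[OF AB n, of "x + y"] path_edge_eq_iff_outside[OF AB, of "x + y"]
      by (cases "x + y \<in> {0..<int (n + 1)}") (auto simp: not_le not_less)
  qed
  then have "d \<in> boundary (region A B) \<longleftrightarrow>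
      d \<in> path_edge A ` {0..<int (n + 1)} \<union> path_edge B ` {0..<int (n + 1)}" for d
    by (metis prod.exhaust)
  then show ?thesis by blast
qed

section \<open>The area of the region\<close>

text \<open>Double counting: an element \<open>a\<close> is counted at the times from
  \<open>a\<close> to \<open>n\<close>, none of them if \<open>a = n + 1\<close>.\<close>

lemma sum_card_atMost:
  fixes A :: "nat set"
  assumes "A \<subseteq> {1..n + 1}"
  shows "(\<Sum>t = 1..n. int (card (A \<inter> {..t}))) = (\<Sum>a\<in>A. int (n + 1) - int a)"
proof -
  have fin: "finite A" using assms by (rule finite_subset) simp
  have "(\<Sum>t = 1..n. int (card (A \<inter> {..t}))) = (\<Sum>t = 1..n. \<Sum>a\<in>A. of_bool (a \<le> t))"
    using fin by (simp add: sum_of_bool_eq atMost_def)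
  also have "\<dots> = (\<Sum>a\<in>A. \<Sum>t = 1..n. of_bool (a \<le> t))"
    by (rule sum.swap)
  also have "\<dots> = (\<Sum>a\<in>A. int (n + 1) - int a)"
  proof (rule sum.cong)
    fix a assume a: "a \<in> A"
    then have "{1..n} \<inter> {t. a \<le> t} = {a..n}" "a \<le> n + 1"
      using assms by auto
    then show "(\<Sum>t = 1..n. of_bool (a \<le> t)) = int (n + 1) - int a"
      by (simp add: sum_of_bool_eq of_nat_diff)
  qed simp
  finally show ?thesis .
qed

lemma card_region:
  assumes AB: "(A, B) \<in> east_times n e"
  shows "finite (region A B)" "int (card (region A B)) = int (\<Sum>A) - int (\<Sum>B)"
proof -
  \<comment> \<open>The pair \<open>(t, x)\<close> stands for the cell in column \<open>x\<close>
    whose centre lies on antidiagonal \<open>t\<close>; its row is \<open>t - 1 - x\<close>.\<close>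
  let ?S = "SIGMA t:{1..n}. {easts A (int t)..<easts B (int t)}"
  have time: "1 \<le> x + y + 1 \<and> x + y + 1 \<le> int n" if "(x, y) \<in> region A B" for x y
  proof (rule ccontr)
    assume "\<not> ?thesis"
    then have "easts A (x + y + 1) = easts B (x + y + 1)"
      using east_timesD(7)[OF AB, of "x + y + 1"] by linarith
    moreover have "easts A (x + y + 1) \<le> x" "x < easts B (x + y + 1)"
      using that by (auto simp: region_def)
    ultimately show False by linarith
  qed
  have bij: "bij_betw (\<lambda>(t, x). (x, int t - 1 - x)) ?S (region A B)"
  proof (rule bij_betwI[where g = "\<lambda>(x, y). (nat (x + y + 1), x)"])
    show "(\<lambda>(x, y). (nat (x + y + 1), x)) \<in> region A B \<rightarrow> ?S"
      using time by (fastforce simp: region_def)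
  next
    fix z assume z: "z \<in> region A B"
    obtain x y where "z = (x, y)" by fastforce
    with z time[of x y]
    show "(\<lambda>(t, x). (x, int t - 1 - x)) ((\<lambda>(x, y). (nat (x + y + 1), x)) z) = z"
      by simp
  qed (auto simp: region_def)
  have "finite ?S" by simp
  then show "finite (region A B)"
    using bij_betw_finite[OF bij] by blast
  have "int (card (region A B)) = int (card ?S)"
    using bij_betw_same_card[OF bij] by simp
  also have "\<dots> = (\<Sum>t = 1..n. easts B (int t) - easts A (int t))"
    using east_timesD(9)[OF AB] by (simp add: card_SigmaI)
  also have "\<dots> = (\<Sum>t = 1..n. int (card (B \<inter> {..t}))) - (\<Sum>t = 1..n. int (card (A \<inter> {..t})))"
    by (simp add: easts_int sum_subtractf)
  also have "\<dots> = (\<Sum>b\<in>B. int (n + 1) - int b) - (\<Sum>a\<in>A. int (n + 1) - int a)"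
    using sum_card_atMost[OF east_timesD(1)[OF AB]] sum_card_atMost[OF east_timesD(2)[OF AB]] by simp
  \<comment> \<open>The terms \<open>n + 1\<close> cancel because \<open>A\<close> and
    \<open>B\<close> have equally many elements.\<close>
  also have "\<dots> = int (\<Sum>A) - int (\<Sum>B)"
    using east_timesD(3,4)[OF AB] by (simp add: sum_subtractf)
  finally show "int (card (region A B)) = int (\<Sum>A) - int (\<Sum>B)" .
qed

section \<open>Parallelogram polyominoes as regions\<close>

lemma card_path_edges_Un:
  assumes "length U = m" "length L = m" "path_edges (0, 0) U \<inter> path_edges (0, 0) L = {}"
  shows "card (path_edges (0, 0) U \<union> path_edges (0, 0) L) = 2 * m"
proof -
  have "finite (path_edges (0, 0) ss)" "card (path_edges (0, 0) ss) = length ss" for ss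
    unfolding path_edges_eq using path_edge_inj by (auto simp: card_image)
  then show ?thesis
    using assms by (simp add: card_Un_disjoint)
qed

lemma parallelogram_polyomino_region:
  assumes AB: "(A, B) \<in> east_times n e" and n: "n \<ge> 1"
  shows "parallelogram_polyomino (e + 1) (n - e) (region A B)"
    and "perimeter (region A B) = 2 * n + 2"
proof -
  note D = east_timesD[OF AB]
  obtain U L where U: "length U = n + 1" "list_east_times U = A"
    and L: "length L = n + 1" "list_east_times L = B"
    using ex_list_east_times[OF D(1)] ex_list_east_times[OF D(2)] by blast
  \<comment> \<open>Ensures \<open>e \<le> n\<close>, so that the height \<open>n - e\<close> is not
    truncated.\<close>
  have "card A \<le> n + 1"
    using card_mono[OF _ D(1)] by simp
  then have e: "e \<le> n" using D(3) by simp
  have fin: "easts A (int n + 1) = int e + 1" "easts B (int n + 1) = int e + 1"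
    using easts_beyond[OF D(1)] easts_beyond[OF D(2)] D(3,4) by auto
  have zero: "easts A 0 = 0" "easts B 0 = 0"
    using easts_nonpos D(5,6) by auto
  \<comment> \<open>The start of an edge reveals its time, so a common edge would occur at the same
    time on both paths.\<close>
  have edges: "path_edges (0, 0) U \<inter> path_edges (0, 0) L = {}"
  proof -
    have "path_edge A t \<noteq> path_edge B t'" if "t \<in> {0..<int (n + 1)}" for t t'
    proof
      assume eq: "path_edge A t = path_edge B t'"
      then have "t = t'"
        by (simp add: path_edge_def path_vertex_def)
      then show False
        using eq path_edge_neq[OF AB n, of t] that by simp
    qed
    then show ?thesis
      unfolding path_edges_eq U L by blast
  qed
  have bd: "boundary (region A B) = path_edges (0, 0) U \<union> path_edges (0, 0) L"
    using boundary_region[OF AB n] by (simp add: path_edges_eq U L)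
  have ends: "path_end (0, 0) U = (int (e + 1), int (n - e))" "path_end (0, 0) L = (int (e + 1), int (n - e))"
    using e fin by (auto simp: path_end_eq U L path_vertex_def algebra_simps of_nat_diff)
  have "path_vertices (0, 0) U \<inter> path_vertices (0, 0) L = {(0, 0), (int (e + 1), int (n - e))}"
  proof (intro equalityI subsetI)
    fix v assume "v \<in> path_vertices (0, 0) U \<inter> path_vertices (0, 0) L"
    then obtain t t' where t: "v = path_vertex A t" "v = path_vertex B t'" "0 \<le> t" "t \<le> int n + 1"
      unfolding path_vertices_eq U L by force
    then have "t = t'" "easts A t = easts B t"
      by (auto simp: path_vertex_def)
    then have "t = 0 \<or> t = int n + 1"
      using D(8)[of t] t by linarith
    then show "v \<in> {(0, 0), (int (e + 1), int (n - e))}"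
      using t zero fin e by (auto simp: path_vertex_def)
  next
    have "path_vertex A 0 = path_vertex B 0" "path_vertex A (int n + 1) = path_vertex B (int n + 1)"
      using zero fin by (auto simp: path_vertex_def)
    moreover have "0 \<in> {0..int (n + 1)}" "int n + 1 \<in> {0..int (n + 1)}"
      by auto
    ultimately have "path_vertex A 0 \<in> path_vertices (0, 0) U \<inter> path_vertices (0, 0) L"
      "path_vertex A (int n + 1) \<in> path_vertices (0, 0) U \<inter> path_vertices (0, 0) L"
      unfolding path_vertices_eq U L by (metis IntI imageI)+
    moreover have "path_vertex A 0 = (0, 0)" "path_vertex A (int n + 1) = (int (e + 1), int (n - e))"
      using zero fin e by (auto simp: path_vertex_def)
    moreover fix v assume "v \<in> {(0, 0), (int (e + 1), int (n - e))}"
    ultimately show "v \<in> path_vertices (0, 0) U \<inter> path_vertices (0, 0) L"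
      by auto
  qed
  moreover have "region A B \<noteq> {}"
  proof -
    \<comment> \<open>The witness is the leftmost cell on antidiagonal \<open>1\<close>, which is
      the cell at the origin.\<close>
    have "easts A 1 < easts B 1" using D(8)[of 1] n by simp
    then have "(easts A 1, - easts A 1) \<in> region A B" by (simp add: region_def)
    then show ?thesis by blast
  qed
  ultimately show "parallelogram_polyomino (e + 1) (n - e) (region A B)"
    unfolding parallelogram_polyomino_def
    using card_region(1)[OF AB] ends edges bd by blast
  show "perimeter (region A B) = 2 * n + 2"
    using card_path_edges_Un[OF U(1) L(1) edges] by (simp add: perimeter_def bd)
qed

lemma length_path_end:
  assumes "path_end (0, 0) ss = (x, y)"
  shows "int (length ss) = x + y"
  using assms by (auto simp: path_end_eq path_vertex_def)

text \<open>A discrete intermediate value argument: the horizontal gap between the paths changes by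
  at most one per step and never vanishes strictly between the end points, so it keeps its initial
  sign.\<close>

lemma list_east_times_in_east_times:
  assumes U: "path_end (0, 0) U = (int (e + 1), int h)" and L: "path_end (0, 0) L = (int (e + 1), int h)"
    and V: "path_vertices (0, 0) U \<inter> path_vertices (0, 0) L = {(0, 0), (int (e + 1), int h)}"
    and len: "e + 1 + h = n + 1"
    and less: "easts (list_east_times U) 1 < easts (list_east_times L) 1"
  shows "(list_east_times U, list_east_times L) \<in> east_times n e"
proof -
  let ?A = "list_east_times U" and ?B = "list_east_times L"
  have lU: "length U = n + 1" and lL: "length L = n + 1"
    using length_path_end[OF U] length_path_end[OF L] len by auto
  have AB: "?A \<subseteq> {1..n + 1}" "?B \<subseteq> {1..n + 1}"
    using list_east_times_subset[of U] list_east_times_subset[of L] lU lL by auto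
  have "easts ?A (int (n + 1)) = int (e + 1)" "easts ?B (int (n + 1)) = int (e + 1)"
    using U L by (auto simp: path_end_eq path_vertex_def lU lL)
  then have card: "card ?A = e + 1" "card ?B = e + 1"
    using easts_beyond[OF AB(1)] easts_beyond[OF AB(2)] by auto
  have neq: "easts ?A t \<noteq> easts ?B t" if t: "1 \<le> t" "t \<le> int n" for t
  proof
    assume "easts ?A t = easts ?B t"
    then have "path_vertex ?A t = path_vertex ?B t"
      by (simp add: path_vertex_def)
    moreover have "t \<in> {0..int (n + 1)}"
      using t by auto
    ultimately have "path_vertex ?A t \<in> path_vertices (0, 0) U \<inter> path_vertices (0, 0) L"
      unfolding path_vertices_eq lU lL by (metis IntI imageI)
    then show False
      unfolding V using t len by (auto simp: path_vertex_def)
  qed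
  have "t \<le> n \<longrightarrow> easts ?A (int t) < easts ?B (int t)" if "1 \<le> t" for t
    using that
  proof (induction t rule: dec_induct)
    case base
    then show ?case using less by simp
  next
    case (step t)
    show ?case
    proof
      assume "Suc t \<le> n"
      then show "easts ?A (int (Suc t)) < easts ?B (int (Suc t))"
        using step neq[of "int t + 1"] easts_plus_one[of ?A "int t"] easts_plus_one[of ?B "int t"]
        by (auto simp: add.commute split: if_splits)
    qed
  qed
  then show ?thesis
    using AB card by (auto simp: east_times_def easts_int)
qed

text \<open>The perimeter fixes the length of both paths, and the boundary fixes the cells. Which
  path is the upper one is not part of the data; it is decided by the first step.\<close>

lemma parallelogram_polyomino_imp_region:
  assumes P: "parallelogram_polyomino (e + 1) h P" and per: "perimeter P = 2 * n + 2" and n: "n \<ge> 1"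
  shows "\<exists>(A, B)\<in>east_times n e. P = region A B"
proof -
  obtain U L where fin: "finite P"
    and U: "path_end (0, 0) U = (int (e + 1), int h)" and L: "path_end (0, 0) L = (int (e + 1), int h)"
    and V: "path_vertices (0, 0) U \<inter> path_vertices (0, 0) L = {(0, 0), (int (e + 1), int h)}"
    and E: "path_edges (0, 0) U \<inter> path_edges (0, 0) L = {}"
    and bd: "boundary P = path_edges (0, 0) U \<union> path_edges (0, 0) L"
    using P unfolding parallelogram_polyomino_def by blast
  have "length U = e + 1 + h" "length L = e + 1 + h"
    using length_path_end[OF U] length_path_end[OF L] by auto
  from card_path_edges_Un[OF this E] have len: "e + 1 + h = n + 1"
    using per by (simp add: perimeter_def bd)
  \<comment> \<open>Stated for arbitrary paths, since the two given ones may have to be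
    exchanged.\<close>
  have *: "P = region (list_east_times U) (list_east_times L)"
    if "(list_east_times U, list_east_times L) \<in> east_times n e"
      "length U = n + 1" "length L = n + 1"
      "boundary P = path_edges (0, 0) U \<union> path_edges (0, 0) L" for U L
  proof (rule boundary_inj[OF fin card_region(1)[OF that(1)]])
    show "boundary P = boundary (region (list_east_times U) (list_east_times L))"
      using boundary_region[OF that(1) n] that(2-4) by (simp add: path_edges_eq)
  qed
  have lU: "length U = n + 1" and lL: "length L = n + 1"
    using length_path_end[OF U] length_path_end[OF L] len by auto
  \<comment> \<open>A common vertex at time \<open>1\<close> has coordinate sum \<open>1\<close>,
    whereas the permitted common vertices have sums \<open>0\<close> and
    \<open>n + 1\<close>.\<close>
  have "easts (list_east_times U) 1 \<noteq> easts (list_east_times L) 1"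
  proof
    assume "easts (list_east_times U) 1 = easts (list_east_times L) 1"
    then have "path_vertex (list_east_times U) 1 = path_vertex (list_east_times L) 1"
      by (simp add: path_vertex_def)
    moreover have "1 \<in> {0..int (n + 1)}"
      by auto
    ultimately have "path_vertex (list_east_times U) 1 \<in> path_vertices (0, 0) U \<inter> path_vertices (0, 0) L"
      unfolding path_vertices_eq lU lL by (metis IntI imageI)
    then show False
      unfolding V using n len by (auto simp: path_vertex_def)
  qed
  then consider "easts (list_east_times U) 1 < easts (list_east_times L) 1"
    | "easts (list_east_times L) 1 < easts (list_east_times U) 1"
    by linarith
  then show ?thesis
  proof cases
    case 1
    from list_east_times_in_east_times[OF U L V len 1] show ?thesis
      using *[OF _ lU lL bd] by blast
  next
    case 2
    from list_east_times_in_east_times[OF L U _ len 2] V have "(list_east_times L, list_east_times U) \<in> east_times n e"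
      by (simp add: Int_commute)
    then show ?thesis
      using *[OF _ lL lU] bd by (auto simp: Un_commute)
  qed
qed

lemma region_antidiagonal:
  "{x. (x, t - 1 - x) \<in> region A B} = {easts A t..<easts B t}"
  by (auto simp: region_def)

text \<open>The counts outside the given range are forced by the inclusions and equal cardinalities,
  and the increments of the counting function reveal the set.\<close>

lemma eq_if_easts_eq:
  assumes A: "A \<subseteq> {1..n + 1}" and C: "C \<subseteq> {1..n + 1}" "card A = card C"
    and eq: "\<And>t. 1 \<le> t \<Longrightarrow> t \<le> int n \<Longrightarrow> easts A t = easts C t"
  shows "A = C"
proof -
  have z: "0 \<notin> A" "0 \<notin> C" using A C by auto
  have all: "easts A t = easts C t" for t
  proof -
    consider "t \<le> 0" | "1 \<le> t \<and> t \<le> int n" | "int (n + 1) \<le> t" by linarith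
    then show ?thesis
      using eq easts_nonpos z easts_beyond[OF A] easts_beyond[OF C(1)] C(2) by cases auto
  qed
  have "i \<in> A \<longleftrightarrow> i \<in> C" for i
  proof (cases i)
    case 0
    then show ?thesis using z by simp
  next
    case (Suc j)
    then show ?thesis
      using all[of "int j"] all[of "int j + 1"] easts_plus_one[OF z(1), of "int j"]
        easts_plus_one[OF z(2), of "int j"] by (auto simp: nat_add_distrib split: if_splits)
  qed
  then show ?thesis by auto
qed

text \<open>The antidiagonal slices at times \<open>1\<close> to \<open>n\<close> are nonempty
  intervals, so their ends, and with them both paths, can be read off the region.\<close>

lemma region_inj:
  "inj_on (\<lambda>(A, B). region A B) (east_times n e)"
proof (rule inj_onI, clarify)
  fix A B C D assume AB: "(A, B) \<in> east_times n e" and CD: "(C, D) \<in> east_times n e"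
    and eq: "region A B = region C D"
  note DA = east_timesD[OF AB] and DC = east_timesD[OF CD]
  have "easts A t = easts C t \<and> easts B t = easts D t" if t: "1 \<le> t" "t \<le> int n" for t
  proof -
    have "{easts A t..<easts B t} = {easts C t..<easts D t}"
      using region_antidiagonal[of t A B] region_antidiagonal[of t C D] eq by simp
    then show ?thesis
      using DA(8)[OF t] DC(8)[OF t] by (simp add: atLeastLessThan_eq_iff)
  qed
  then show "A = C \<and> B = D"
    using eq_if_easts_eq[OF DA(1) DC(1)] eq_if_easts_eq[OF DA(2) DC(2)] DA(3,4) DC(3,4) by auto
qed

text \<open>The height \<open>h\<close> may be left existential: width and perimeter force it to be
  \<open>n - e\<close>.\<close>

lemma bij_betw_region:
  assumes n: "n \<ge> 1"
  shows "bij_betw (\<lambda>(A, B). region A B)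
    {(A, B) \<in> east_times n e. int (\<Sum>A) - int (\<Sum>B) = a}
    {P. \<exists>h. parallelogram_polyomino (e + 1) h P \<and> perimeter P = 2 * n + 2 \<and> int (card P) = a}"
    (is "bij_betw ?f ?S ?T")
proof (rule bij_betw_imageI)
  show "inj_on ?f ?S"
    by (rule inj_on_subset[OF region_inj]) auto
  show "?f ` ?S = ?T"
  proof (intro equalityI subsetI)
    fix P assume "P \<in> ?f ` ?S"
    then show "P \<in> ?T"
      using parallelogram_polyomino_region[OF _ n] card_region(2) by fastforce
  next
    fix P assume "P \<in> ?T"
    then obtain A B where "(A, B) \<in> east_times n e" "P = region A B" "int (card P) = a"
      using parallelogram_polyomino_imp_region[OF _ _ n] by blast
    then show "P \<in> ?f ` ?S"
      using card_region(2) by (auto intro!: image_eqI[where x = "(A, B)"])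
  qed
qed

theorem theorem3p10:
  fixes n e k :: nat
  assumes "n \<ge> 1"
  shows "\<exists>f. bij_betw f
    {p. p permutes {1..n} \<and> bi_increasing n p \<and> exc n p = e \<and> dexc n p = k}
    {P. \<exists>h. parallelogram_polyomino (e + 1) h P \<and> perimeter P = 2 * n + 2 \<and>
            int (card P) = int n + int k - int e}"
  \<comment> \<open>The two bijections meet in the set of pairs with
    \<open>a = int n + int k - int e\<close>.\<close>
  using bij_betw_trans[OF bij_betw_permutation_east_times[OF assms] bij_betw_region[OF assms]]
  by blast

end
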